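(* Let $n\in\mathbb{N}$. For all integers $0\le k\le n$, there exists a bijection between the $k$-dimensional faces of the permutohedron $P(n)$ of order $n$ and the unit-interval parking functions of length $n$ with total displacement $k$.
   Context: The permutohedron of order $n$ is $P(n)=\operatorname{conv}\{(w(1),\dots,w(n)) : w \text{ a permutation of } [n]\}\subset\mathbb{R}^n$, an $(n-1)$-dimensional polytope; its faces include $P(n)$ itself. A parking function of length $n$ is $\alpha=(a_1,\dots,a_n)\in[n]^n$ such that, when cars $1,\dots,n$ arrive in order on a one-way street with spots $1,\dots,n$ and car $i$ parks in the first unoccupied spot $\ge a_i$, every car parks. If car $i$ parks in spot $s_i$, its displacement is $s_i-a_i$, and the total displacement is $\sum_i(s_i-a_i)$. A unit-interval parking function is one in which every car has displacement at most $1$. *)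

theory Defs
  imports "HOL-Analysis.Analysis"
begin

text \<open>
  The coordinates of \<open>real ^ 'n\<close> are labelled by the elements of \<open>'n\<close> instead of
  \<open>1, \<dots>, n\<close> with \<open>n = CARD('n)\<close>. A permutation of \<open>{1..n}\<close> in one-line notation
  is then a bijection from the labels onto \<open>{1..n}\<close>; the set of all these vectors does not
  depend on how the labels are ordered.
\<close>

definition permutohedron :: "(real ^ 'n) set" where
  "permutohedron =
     convex hull {(\<chi> i. real (w i)) | w :: 'n \<Rightarrow> nat. bij_betw w UNIV {1..CARD('n)}}"

text \<open>
  \<open>park n U as\<close> parks cars with preferences \<open>as\<close> in order on a street with spots
  \<open>1, \<dots>, n\<close>, of which those in \<open>U\<close> are already occupied; \<open>None\<close> stands for a car that
  leaves without parking.
\<close>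

primrec park :: "nat \<Rightarrow> nat set \<Rightarrow> nat list \<Rightarrow> nat option list" where
  "park n U [] = []"
| "park n U (a # as) =
     (let free = {s \<in> {1..n}. s \<ge> a \<and> s \<notin> U} in
      if free = {} then None # park n U as
      else Some (Min free) # park n (insert (Min free) U) as)"

definition parking_function :: "nat \<Rightarrow> nat list \<Rightarrow> bool" where
  "parking_function n \<alpha> \<longleftrightarrow>
     length \<alpha> = n \<and> set \<alpha> \<subseteq> {1..n} \<and> None \<notin> set (park n {} \<alpha>)"

text \<open>
  The index \<open>i\<close> of a car starts at \<open>0\<close>. The notions below are only meaningful if \<open>\<alpha>\<close> is a
  parking function; the subtraction then does not truncate, as a car never parks before its
  preferred spot.
\<close>

definition parking_spot :: "nat list \<Rightarrow> nat \<Rightarrow> nat" where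
  "parking_spot \<alpha> i = the (park (length \<alpha>) {} \<alpha> ! i)"

definition displacement :: "nat list \<Rightarrow> nat \<Rightarrow> nat" where
  "displacement \<alpha> i = parking_spot \<alpha> i - \<alpha> ! i"

definition total_displacement :: "nat list \<Rightarrow> nat" where
  "total_displacement \<alpha> = (\<Sum>i<length \<alpha>. displacement \<alpha> i)"

definition unit_interval_parking_function :: "nat \<Rightarrow> nat list \<Rightarrow> bool" where
  "unit_interval_parking_function n \<alpha> \<longleftrightarrow>
     parking_function n \<alpha> \<and> (\<forall>i<n. displacement \<alpha> i \<le> 1)"

end

theory Submission
  imports Defs
begin

text \<open>
  Both sides are in bijection with the weak orders on the \<open>n\<close> labels, encoded as rankings with ties.

  A nonempty face of the permutohedron is exposed, hence the set of maximizers of some linear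
  functional \<open>x\<close>. Swapping two entries shows that a permutation maximizes \<open>x\<close> iff it is increasing
  along the weak order defined by the coordinates of \<open>x\<close>, so that the face depends only on this
  weak order. The vectors orthogonal to all differences of points of the face are those that are
  constant on its blocks of ties; with \<open>m\<close> blocks the face therefore has dimension \<open>n - m\<close>.

  In a unit-interval parking function, a displaced car parks directly behind an earlier car. The
  street thus splits into runs of spots, each consisting of one undisplaced car followed by
  displaced cars in their order of arrival. The runs are the blocks of a weak order, and with \<open>m\<close>
  runs the total displacement is \<open>n - m\<close>.
\<close>

section \<open>Unit-interval parking functions and rankings\<close>

text \<open>Zero-based competition rankings: \<open>r i\<close> counts the elements ranked strictly below \<open>i\<close>. They are
  canonical representatives of ordered set partitions.\<close>

definition ranking_on :: "'a set \<Rightarrow> ('a \<Rightarrow> nat) \<Rightarrow> bool" where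
  "ranking_on I r \<longleftrightarrow> (\<forall>i\<in>I. r i = card {j \<in> I. r j < r i})"

text \<open>When car \<open>i\<close> arrives, the occupied spots are \<open>U\<close> and those of
  the earlier cars. Being the least free spot therefore becomes a condition on each car separately,
  and later proofs need no recursion on \<open>park\<close>.\<close>

lemma park_eq_map_Some_iff:
  "park n U as = map Some ss \<longleftrightarrow>
     length ss = length as \<and>
     (\<forall>i<length as. ss ! i \<in> {1..n} \<and> as ! i \<le> ss ! i \<and> ss ! i \<notin> U \<union> set (take i ss) \<and>
        (\<forall>p. 1 \<le> p \<longrightarrow> as ! i \<le> p \<longrightarrow> p < ss ! i \<longrightarrow> p \<in> U \<union> set (take i ss)))"
proof (induction as arbitrary: U ss)
  case Nil
  show ?case by auto
next
  case (Cons a as)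
  define free where "free = {s \<in> {1..n}. s \<ge> a \<and> s \<notin> U}"
  have fin: "finite free" by (simp add: free_def)
  show ?case
  proof (cases ss)
    case Nil
    then show ?thesis by (simp add: Let_def)
  next
    case (Cons s ss')
    have head: "free \<noteq> {} \<and> Min free = s \<longleftrightarrow>
        s \<in> {1..n} \<and> a \<le> s \<and> s \<notin> U \<and> (\<forall>p. 1 \<le> p \<longrightarrow> a \<le> p \<longrightarrow> p < s \<longrightarrow> p \<in> U)"
    proof
      assume "free \<noteq> {} \<and> Min free = s"
      then have "s \<in> free" "\<And>p. p \<in> free \<Longrightarrow> s \<le> p"
        using fin Min_in[of free] Min_le[of free] by auto
      then show "s \<in> {1..n} \<and> a \<le> s \<and> s \<notin> U \<and> (\<forall>p. 1 \<le> p \<longrightarrow> a \<le> p \<longrightarrow> p < s \<longrightarrow> p \<in> U)"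
        unfolding free_def by force
    next
      assume R: "s \<in> {1..n} \<and> a \<le> s \<and> s \<notin> U \<and> (\<forall>p. 1 \<le> p \<longrightarrow> a \<le> p \<longrightarrow> p < s \<longrightarrow> p \<in> U)"
      then have "s \<in> free" "\<And>p. p \<in> free \<Longrightarrow> s \<le> p"
        unfolding free_def by (auto simp: not_less[symmetric])
      then show "free \<noteq> {} \<and> Min free = s"
        using fin by (auto intro!: Min_eqI)
    qed
    have "park n U (a # as) = map Some ss \<longleftrightarrow>
        (free \<noteq> {} \<and> Min free = s) \<and> park n (insert s U) as = map Some ss'"
      unfolding park.simps free_def[symmetric] Let_def Cons by auto
    \<comment> \<open>Car 0 is split off the bounded quantifier. For the other cars,
      \<open>insert s U\<close> with \<open>take i ss'\<close> gives the same set as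
      \<open>U\<close> with \<open>take (Suc i) ss\<close>.\<close>
    also have "\<dots> \<longleftrightarrow> length ss = length (a # as) \<and>
     (\<forall>i<length (a # as). ss ! i \<in> {1..n} \<and> (a # as) ! i \<le> ss ! i \<and> ss ! i \<notin> U \<union> set (take i ss) \<and>
        (\<forall>p. 1 \<le> p \<longrightarrow> (a # as) ! i \<le> p \<longrightarrow> p < ss ! i \<longrightarrow> p \<in> U \<union> set (take i ss)))"
      unfolding head Cons.IH Cons length_Cons All_less_Suc2
      by (simp, blast)
    finally show ?thesis .
  qed
qed

lemma length_park [simp]: "length (park n U as) = length as"
  by (induction as arbitrary: U) (auto simp: Let_def)

text \<open>A local certificate that unit-interval parking has outcome \<open>s\<close>. Bijectivity
  stands for every car finding its spot free, and the last clause says that a displaced car was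
  pushed on by an earlier car in its preferred spot.\<close>

definition unit_parks :: "nat \<Rightarrow> nat list \<Rightarrow> (nat \<Rightarrow> nat) \<Rightarrow> bool" where
  "unit_parks n \<alpha> s \<longleftrightarrow> length \<alpha> = n \<and> (\<forall>i<n. 1 \<le> \<alpha> ! i) \<and> bij_betw s {..<n} {1..n} \<and>
     (\<forall>i<n. s i = \<alpha> ! i \<or> s i = Suc (\<alpha> ! i) \<and> (\<exists>j<i. s j = \<alpha> ! i))"

lemma set_take_map_upt: "i \<le> n \<Longrightarrow> set (take i (map s [0..<n])) = s ` {..<i}"
  by (auto simp: take_map)

lemma unit_parks_imp_park:
  assumes "unit_parks n \<alpha> s"
  shows "park n {} \<alpha> = map Some (map s [0..<n])"
proof -
  have bij: "bij_betw s {..<n} {1..n}" and len: "length \<alpha> = n"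
    and st: "\<And>i. i < n \<Longrightarrow> s i = \<alpha> ! i \<or> s i = Suc (\<alpha> ! i) \<and> (\<exists>j<i. s j = \<alpha> ! i)"
    using assms unfolding unit_parks_def by auto
  have "s i \<in> {1..n} \<and> \<alpha> ! i \<le> s i \<and> s i \<notin> s ` {..<i} \<and>
      (\<forall>p. 1 \<le> p \<longrightarrow> \<alpha> ! i \<le> p \<longrightarrow> p < s i \<longrightarrow> p \<in> s ` {..<i})" if "i < n" for i
  proof (intro conjI allI impI)
    show "s i \<in> {1..n}" using bij that by (auto simp: bij_betw_def)
    show "\<alpha> ! i \<le> s i" using st[OF that] by auto
    show "s i \<notin> s ` {..<i}"
      using bij that by (force simp: bij_betw_def inj_on_def)
    \<comment> \<open>With displacement at most 1, the only spot passed over is the preferred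
      one.\<close>
    fix p assume "\<alpha> ! i \<le> p" "p < s i"
    then have "p = \<alpha> ! i" "\<exists>j<i. s j = \<alpha> ! i" using st[OF that] by auto
    then show "p \<in> s ` {..<i}" by force
  qed
  then show ?thesis
    unfolding park_eq_map_Some_iff by (simp add: len set_take_map_upt)
qed

lemma unit_parks_parking_spot:
  assumes "unit_parks n \<alpha> s" "i < n"
  shows "parking_spot \<alpha> i = s i"
  using unit_parks_imp_park[OF assms(1)] assms by (simp add: parking_spot_def unit_parks_def)

lemma unit_parks_imp_unit_interval:
  assumes "unit_parks n \<alpha> s"
  shows "unit_interval_parking_function n \<alpha>"
proof -
  have bij: "bij_betw s {..<n} {1..n}" and len: "length \<alpha> = n" and pos: "\<And>i. i < n \<Longrightarrow> 1 \<le> \<alpha> ! i"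
    and st: "\<And>i. i < n \<Longrightarrow> s i = \<alpha> ! i \<or> s i = Suc (\<alpha> ! i) \<and> (\<exists>j<i. s j = \<alpha> ! i)"
    using assms unfolding unit_parks_def by auto
  have "\<alpha> ! i \<in> {1..n}" if "i < n" for i
    using st[OF that] pos[OF that] bij_betwE[OF bij] that by (metis atLeastAtMost_iff lessThan_iff Suc_leD)
  then have "set \<alpha> \<subseteq> {1..n}" using len by (auto simp: in_set_conv_nth)
  moreover have "displacement \<alpha> i \<le> 1" if "i < n" for i
    using unit_parks_parking_spot[OF assms that] st[OF that] by (auto simp: displacement_def)
  ultimately show ?thesis
    unfolding unit_interval_parking_function_def parking_function_def
    using unit_parks_imp_park[OF assms] len by auto
qed

text \<open>A displaced car passes over its preferred spot, so the greedy rule yields the earlier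
  car parked there. Distinct spots within \<open>{1..n}\<close> give bijectivity by
  counting.\<close>

lemma unit_interval_imp_unit_parks:
  assumes "unit_interval_parking_function n \<alpha>"
  shows "unit_parks n \<alpha> (parking_spot \<alpha>)"
proof -
  let ?s = "parking_spot \<alpha>"
  have len: "length \<alpha> = n" and rng: "set \<alpha> \<subseteq> {1..n}" and nn: "None \<notin> set (park n {} \<alpha>)"
    and disp: "\<And>i. i < n \<Longrightarrow> ?s i - \<alpha> ! i \<le> 1"
    using assms by (auto simp: unit_interval_parking_function_def parking_function_def displacement_def)
  have "park n {} \<alpha> ! i = Some (?s i)" if "i < n" for i
  proof -
    have "park n {} \<alpha> ! i \<noteq> None" using nn len that by (metis length_park nth_mem)
    then show ?thesis by (auto simp: parking_spot_def len)
  qed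
  then have "park n {} \<alpha> = map Some (map ?s [0..<n])"
    by (intro nth_equalityI) (auto simp: len)
  then have P: "?s i \<in> {1..n}" "\<alpha> ! i \<le> ?s i" "?s i \<notin> ?s ` {..<i}"
      "\<And>p. 1 \<le> p \<Longrightarrow> \<alpha> ! i \<le> p \<Longrightarrow> p < ?s i \<Longrightarrow> p \<in> ?s ` {..<i}" if "i < n" for i
    using that unfolding park_eq_map_Some_iff by (simp_all add: len set_take_map_upt)
  have pos: "1 \<le> \<alpha> ! i" if "i < n" for i
    using rng len that by (metis atLeastAtMost_iff nth_mem subsetD)
  have "inj_on ?s {..<n}"
  proof (rule linorder_inj_onI)
    fix x y assume "x < y" "x \<in> {..<n}" "y \<in> {..<n}"
    then show "?s x \<noteq> ?s y" using P(3)[of y] by (metis imageI lessThan_iff)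
  qed auto
  moreover have "?s ` {..<n} \<subseteq> {1..n}" using P(1) by blast
  ultimately have bij: "bij_betw ?s {..<n} {1..n}"
    unfolding bij_betw_def by (simp add: card_image card_subset_eq)
  have "?s i = \<alpha> ! i \<or> ?s i = Suc (\<alpha> ! i) \<and> (\<exists>j<i. ?s j = \<alpha> ! i)" if "i < n" for i
  proof (cases "?s i = \<alpha> ! i")
    case False
    then have "?s i = Suc (\<alpha> ! i)" using disp[OF that] P(2)[OF that] by linarith
    moreover have "\<alpha> ! i \<in> ?s ` {..<i}" using P(4)[OF that, of "\<alpha> ! i"] pos[OF that] calculation by simp
    ultimately show ?thesis by force
  qed simp
  then show ?thesis using bij len pos unfolding unit_parks_def by blast
qed

lemma unit_parks_total_displacement:
  assumes "unit_parks n \<alpha> s"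
  shows "total_displacement \<alpha> = card {i. i < n \<and> s i \<noteq> \<alpha> ! i}"
proof -
  have len: "length \<alpha> = n" using assms by (simp add: unit_parks_def)
  have "displacement \<alpha> i = (if s i \<noteq> \<alpha> ! i then 1 else 0)" if "i < n" for i
    using assms that unit_parks_parking_spot[OF assms that]
    by (force simp: displacement_def unit_parks_def)
  then have "total_displacement \<alpha> = (\<Sum>i<n. if s i \<noteq> \<alpha> ! i then 1 else 0)"
    unfolding total_displacement_def len by (intro sum.cong) auto
  also have "\<dots> = card {i. i < n \<and> s i \<noteq> \<alpha> ! i}"
    by (simp add: sum.If_cases Int_def conj_commute)
  finally show ?thesis .
qed

section \<open>From rankings to parking functions and back\<close>

definition ties_before :: "(nat \<Rightarrow> nat) \<Rightarrow> nat \<Rightarrow> nat" where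
  "ties_before r i = card {j. j < i \<and> r j = r i}"

text \<open>Since \<open>r i\<close> cars belong to earlier blocks, the block of \<open>i\<close>
  starts at spot \<open>Suc (r i)\<close>. It is filled in order of arrival, and
  \<open>ties_before\<close> is the position of a car in its block, counted from 0.\<close>

definition ranking_spot :: "(nat \<Rightarrow> nat) \<Rightarrow> nat \<Rightarrow> nat" where
  "ranking_spot r i = Suc (r i + ties_before r i)"

text \<open>The first car of a block prefers the spot \<open>r i + 1\<close> where it parks, and the
  car at position \<open>t > 0\<close> prefers \<open>r i + t\<close>, one before its own spot. Both
  cases are merged by \<open>max 1\<close>.\<close>

definition ranking_prefs :: "nat \<Rightarrow> (nat \<Rightarrow> nat) \<Rightarrow> nat list" where
  "ranking_prefs n r = map (\<lambda>i. r i + max 1 (ties_before r i)) [0..<n]"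

lemma nth_ranking_prefs [simp]: "i < n \<Longrightarrow> ranking_prefs n r ! i = r i + max 1 (ties_before r i)"
  by (simp add: ranking_prefs_def)

lemma ranking_on_card_le:
  assumes "ranking_on I r" "finite I" "i \<in> I"
  shows "card {j \<in> I. r j \<le> r i} = r i + card {j \<in> I. r j = r i}"
proof -
  have "{j \<in> I. r j \<le> r i} = {j \<in> I. r j < r i} \<union> {j \<in> I. r j = r i}" by auto
  then have "card {j \<in> I. r j \<le> r i} = card {j \<in> I. r j < r i} + card {j \<in> I. r j = r i}"
    using assms by (simp add: card_Un_disjoint disjoint_iff)
  then show ?thesis using assms by (simp add: ranking_on_def)
qed

lemma ties_before_less:
  assumes "i < n" shows "ties_before r i < card {j \<in> {..<n}. r j = r i}"
  unfolding ties_before_def by (rule psubset_card_mono) (use assms in auto)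

lemma ranking_spot_le:
  assumes "ranking_on {..<n} r" "i < n"
  shows "ranking_spot r i \<le> card {j \<in> {..<n}. r j \<le> r i}"
  using ties_before_less[OF assms(2), of r] ranking_on_card_le[OF assms(1), of i] assms(2)
  by (simp add: ranking_spot_def)

text \<open>The block of \<open>i\<close> ends at the number of cars ranked at most
  \<open>r i\<close>. All of these are counted by \<open>r j\<close>, so the block of
  \<open>j\<close> starts later.\<close>

lemma ranking_spot_less_of_rank_less:
  assumes "ranking_on {..<n} r" "i < n" "j < n" "r i < r j"
  shows "ranking_spot r i < ranking_spot r j"
proof -
  have "card {l \<in> {..<n}. r l \<le> r i} \<le> card {l \<in> {..<n}. r l < r j}"
    by (rule card_mono) (use assms in auto)
  also have "\<dots> = r j" using assms unfolding ranking_on_def by simp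
  finally show ?thesis using ranking_spot_le[OF assms(1,2)] by (simp add: ranking_spot_def)
qed

lemma ranking_spot_less_of_tie:
  assumes "r i = r j" "i < j"
  shows "ranking_spot r i < ranking_spot r j"
proof -
  have "ties_before r i < ties_before r j"
    unfolding ties_before_def by (rule psubset_card_mono) (use assms in auto)
  then show ?thesis using assms by (simp add: ranking_spot_def)
qed

text \<open>Take the latest earlier car of the same block; it is the one that parks directly in
  front of \<open>i\<close>.\<close>

lemma tied_predecessor:
  assumes "ties_before r i \<noteq> 0"
  obtains j where "j < i" "r j = r i" "ties_before r i = Suc (ties_before r j)"
proof -
  let ?T = "{j. j < i \<and> r j = r i}"
  have ne: "?T \<noteq> {}" using assms unfolding ties_before_def by (metis card.empty)
  define j where "j = Max ?T"
  have fin: "finite ?T" by simp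
  have j: "j \<in> ?T" "\<And>l. l \<in> ?T \<Longrightarrow> l \<le> j"
    unfolding j_def using Max_in[OF fin ne] Max_ge[OF fin] by blast+
  have "?T = insert j {l. l < j \<and> r l = r j}" using j by (auto simp: le_less)
  then have "ties_before r i = Suc (ties_before r j)" unfolding ties_before_def by simp
  then show ?thesis using that j(1) by blast
qed

text \<open>Spots increase strictly along the order by rank and then by arrival, so they are
  distinct, and counting makes them a bijection. The preferred spot of a displaced car is held by
  its tied predecessor.\<close>

lemma ranking_unit_parks:
  assumes r: "ranking_on {..<n} r"
  shows "unit_parks n (ranking_prefs n r) (ranking_spot r)"
proof -
  have "inj_on (ranking_spot r) {..<n}"
  proof (rule linorder_inj_onI)
    fix i j assume "i < j" "i \<in> {..<n}" "j \<in> {..<n}"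
    then show "ranking_spot r i \<noteq> ranking_spot r j"
      using ranking_spot_less_of_rank_less[OF r, of i j] ranking_spot_less_of_rank_less[OF r, of j i]
        ranking_spot_less_of_tie[of r i j]
      by (metis lessThan_iff less_irrefl linorder_neqE_nat)
  qed auto
  moreover have "ranking_spot r i \<in> {1..n}" if "i < n" for i
  proof -
    have "card {j \<in> {..<n}. r j \<le> r i} \<le> card {..<n}" by (rule card_mono) auto
    then show ?thesis using ranking_spot_le[OF r that] by (simp add: ranking_spot_def)
  qed
  then have "ranking_spot r ` {..<n} \<subseteq> {1..n}" by blast
  ultimately have "bij_betw (ranking_spot r) {..<n} {1..n}"
    unfolding bij_betw_def by (simp add: card_image card_subset_eq)
  moreover have "ranking_spot r i = ranking_prefs n r ! i \<or> ranking_spot r i = Suc (ranking_prefs n r ! i)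
      \<and> (\<exists>j<i. ranking_spot r j = ranking_prefs n r ! i)" if "i < n" for i
  proof (cases "ties_before r i = 0")
    case True
    then show ?thesis using that by (simp add: ranking_spot_def)
  next
    case False
    then obtain j where "j < i" "r j = r i" "ties_before r i = Suc (ties_before r j)"
      by (rule tied_predecessor)
    then have "ranking_spot r j = ranking_prefs n r ! i" using that by (simp add: ranking_spot_def)
    then show ?thesis using False that \<open>j < i\<close> by (auto simp: ranking_spot_def)
  qed
  moreover have "1 \<le> ranking_prefs n r ! i" if "i < n" for i using that by simp
  ultimately show ?thesis
    unfolding unit_parks_def by (auto simp: ranking_prefs_def)
qed

lemma ranking_spot_eq_prefs_iff:
  assumes "i < n"
  shows "ranking_spot r i = ranking_prefs n r ! i \<longleftrightarrow> ties_before r i = 0"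
  using assms by (auto simp: ranking_spot_def)

lemma first_occurrence:
  obtains m where "m \<le> i" "r m = r i" "ties_before r m = 0"
proof -
  define m where "m = (LEAST m. r m = r i)"
  have "r m = r i" "m \<le> i" "\<And>j. j < m \<Longrightarrow> r j \<noteq> r i"
    unfolding m_def by (auto intro: LeastI Least_le dest: not_less_Least)
  then show ?thesis using that[of m] by (auto simp: ties_before_def)
qed

text \<open>Each block has exactly one first car, so mapping first cars to their ranks is a
  bijection.\<close>

lemma card_first_occurrences:
  "card {i. i < n \<and> ties_before r i = 0} = card (r ` {..<n})"
proof (rule bij_betw_same_card[of r])
  have tb: "ties_before r i = 0 \<longleftrightarrow> (\<forall>j<i. r j \<noteq> r i)" for i
    unfolding ties_before_def by auto
  show "bij_betw r {i. i < n \<and> ties_before r i = 0} (r ` {..<n})"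
    unfolding bij_betw_def
  proof
    show "inj_on r {i. i < n \<and> ties_before r i = 0}"
      unfolding tb by (rule linorder_inj_onI) auto
    have "r i \<in> r ` {i. i < n \<and> ties_before r i = 0}" if "i < n" for i
    proof -
      obtain m where "m \<le> i" "r m = r i" "ties_before r m = 0" by (rule first_occurrence)
      then show ?thesis using that by (intro image_eqI[of _ _ m]) auto
    qed
    then show "r ` {i. i < n \<and> ties_before r i = 0} = r ` {..<n}" by auto
  qed
qed

lemma ranking_total_displacement:
  assumes r: "ranking_on {..<n} r"
  shows "total_displacement (ranking_prefs n r) + card (r ` {..<n}) = n"
proof -
  have "total_displacement (ranking_prefs n r) = card {i. i < n \<and> ties_before r i \<noteq> 0}"
    unfolding unit_parks_total_displacement[OF ranking_unit_parks[OF r]]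
    by (intro arg_cong[where f = card] Collect_cong conj_cong refl)
      (simp add: ranking_spot_eq_prefs_iff del: nth_ranking_prefs)
  moreover have "{..<n} = {i. i < n \<and> ties_before r i \<noteq> 0} \<union> {i. i < n \<and> ties_before r i = 0}"
    by auto
  then have "card {..<n} = card {i. i < n \<and> ties_before r i \<noteq> 0} + card {i. i < n \<and> ties_before r i = 0}"
    by (metis (no_types, lifting) card_Un_disjoint disjoint_iff finite_Un finite_lessThan mem_Collect_eq)
  ultimately show ?thesis by (simp add: card_first_occurrences)
qed

text \<open>A block of tied cars occupies consecutive spots, and its first spot is the only one taken
  without displacement; this is how the ranking is read off a parking function.\<close>

definition block_start :: "nat \<Rightarrow> nat list \<Rightarrow> (nat \<Rightarrow> nat) \<Rightarrow> nat \<Rightarrow> nat" where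
  "block_start n \<alpha> s p = Max {s j | j. j < n \<and> s j = \<alpha> ! j \<and> s j \<le> p}"

text \<open>The first car of the block of \<open>i\<close> is undisplaced in spot
  \<open>Suc (r i)\<close>. Any other undisplaced car parked no later than \<open>i\<close> starts a
  block of rank at most \<open>r i\<close>, hence no later.\<close>

lemma ranking_block_start:
  assumes r: "ranking_on {..<n} r" and i: "i < n"
  shows "block_start n (ranking_prefs n r) (ranking_spot r) (ranking_spot r i) = Suc (r i)"
proof -
  obtain m where "m \<le> i" and m: "r m = r i" "ties_before r m = 0" by (rule first_occurrence)
  then have "m < n" using i by simp
  show ?thesis
    unfolding block_start_def
  proof (rule Max_eqI)
    show "finite {ranking_spot r j |j. j < n \<and> ranking_spot r j = ranking_prefs n r ! j
        \<and> ranking_spot r j \<le> ranking_spot r i}" by simp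
    have "Suc (r i) = ranking_spot r m" "ranking_spot r m \<le> ranking_spot r i"
      using m by (auto simp: ranking_spot_def)
    then show "Suc (r i) \<in> {ranking_spot r j |j. j < n \<and> ranking_spot r j = ranking_prefs n r ! j
        \<and> ranking_spot r j \<le> ranking_spot r i}"
      using m \<open>m < n\<close> ranking_spot_eq_prefs_iff[of m n r] by blast
    fix p assume "p \<in> {ranking_spot r j |j. j < n \<and> ranking_spot r j = ranking_prefs n r ! j
        \<and> ranking_spot r j \<le> ranking_spot r i}"
    then obtain j where j: "j < n" "ties_before r j = 0" "ranking_spot r j \<le> ranking_spot r i"
        "p = ranking_spot r j"
      using ranking_spot_eq_prefs_iff by blast
    then have "r j \<le> r i"
      using ranking_spot_less_of_rank_less[OF r i, of j] by (meson not_less)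
    then show "p \<le> Suc (r i)" using j by (simp add: ranking_spot_def)
  qed
qed

text \<open>The preferences determine the spots, both together determine the block starts, and these
  are the ranks plus 1.\<close>

lemma ranking_prefs_inj:
  assumes r: "ranking_on {..<n} r" and r': "ranking_on {..<n} r'"
    and eq: "ranking_prefs n r = ranking_prefs n r'" and i: "i < n"
  shows "r i = r' i"
proof -
  have s: "ranking_spot r j = ranking_spot r' j" if "j < n" for j
    using unit_parks_parking_spot[OF ranking_unit_parks[OF r] that]
      unit_parks_parking_spot[OF ranking_unit_parks[OF r'] that] eq by simp
  have "Suc (r i) = block_start n (ranking_prefs n r) (ranking_spot r) (ranking_spot r i)"
    using ranking_block_start[OF r i] by simp
  also have "\<dots> = block_start n (ranking_prefs n r') (ranking_spot r') (ranking_spot r' i)"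
    unfolding block_start_def eq s[OF i]
    by (rule arg_cong[where f = Max], rule Collect_cong) (metis s)
  also have "\<dots> = Suc (r' i)" by (rule ranking_block_start[OF r' i])
  finally show ?thesis by simp
qed

text \<open>The rank of a car is the number of spots before its run. It remains to check that this
  counts the cars of lower rank, and that each run is filled in order of arrival.\<close>

lemma ranking_prefs_surj:
  assumes up: "unit_parks n \<alpha> s"
  obtains r where "ranking_on {..<n} r" "ranking_prefs n r = \<alpha>"
proof -
  have bij: "bij_betw s {..<n} {1..n}" and len: "length \<alpha> = n" and pos: "\<And>i. i < n \<Longrightarrow> 1 \<le> \<alpha> ! i"
    and st: "\<And>i. i < n \<Longrightarrow> s i = \<alpha> ! i \<or> s i = Suc (\<alpha> ! i) \<and> (\<exists>j<i. s j = \<alpha> ! i)"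
    using up unfolding unit_parks_def by auto
  have inj: "i = j" if "s i = s j" "i < n" "j < n" for i j
    using bij that by (auto simp: bij_betw_def inj_on_def)
  have ex: "\<exists>j<n. s j = p" if "1 \<le> p" "p \<le> n" for p
  proof -
    have "p \<in> s ` {..<n}" using bij that by (simp add: bij_betw_def)
    then show ?thesis by auto
  qed
  have rng: "1 \<le> s i" "s i \<le> n" if "i < n" for i
    using bij_betwE[OF bij] that by auto
  define B where "B p = block_start n \<alpha> s p" for p
  have B: "(\<exists>j<n. s j = \<alpha> ! j \<and> s j = B p) \<and> B p \<le> p \<and> (\<forall>j<n. s j = \<alpha> ! j \<longrightarrow> s j \<le> p \<longrightarrow> s j \<le> B p)"
    if "1 \<le> p" "p \<le> n" for p
  proof -
    let ?S = "{s j | j. j < n \<and> s j = \<alpha> ! j \<and> s j \<le> p}"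
    have fin: "finite ?S" by simp
    \<comment> \<open>The car in spot 1 is undisplaced, since otherwise its preference would be 0.
      So the maximum is taken over a nonempty set.\<close>
    have "1 \<le> n" using that by simp
    then obtain j where j: "j < n" "s j = 1" using ex[of 1] by auto
    then have "s j = \<alpha> ! j" using st[of j] pos[of j] by auto
    then have "?S \<noteq> {}" using j that by force
    then have in_S: "B p \<in> ?S" unfolding B_def block_start_def using fin by (rule Max_in[rotated])
    have "s l \<le> B p" if "l < n" "s l = \<alpha> ! l" "s l \<le> p" for l
      unfolding B_def block_start_def by (rule Max_ge[OF fin]) (use that in blast)
    moreover obtain l where "B p = s l" "l < n" "s l = \<alpha> ! l" "s l \<le> p" using in_S by blast
    ultimately show ?thesis by metis
  qed
  \<comment> \<open>Shifted by 1 because ranks start at 0. No truncation occurs, as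
    \<open>B (s i)\<close> is a spot and hence positive.\<close>
  define r where "r i = B (s i) - 1" for i
  have Br: "B (s i) = Suc (r i)" if i: "i < n" for i
  proof -
    obtain j where "j < n" "s j = B (s i)" using B[OF rng[OF i]] by blast
    then show ?thesis using rng[of j] by (simp add: r_def)
  qed
  have r_less: "r i < s i" if "i < n" for i using B[OF rng[OF that]] Br[OF that] by simp
  \<comment> \<open>Runs are intervals: the run of \<open>i\<close> starts at
    \<open>Suc (r i)\<close> with an undisplaced car, and a car parked there or later has its own
    run start no earlier.\<close>
  have r_less_iff: "r j < r i \<longleftrightarrow> s j \<le> r i" if i: "i < n" and j: "j < n" for i j
  proof
    assume "r j < r i"
    obtain l where l: "l < n" "s l = \<alpha> ! l" "s l = Suc (r i)"
      using B[OF rng[OF i]] Br[OF i] by auto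
    then have "\<not> s l \<le> s j"
      using B[OF rng[OF j]] Br[OF j] \<open>r j < r i\<close> by auto
    then show "s j \<le> r i" using l by simp
  next
    assume "s j \<le> r i"
    then show "r j < r i" using r_less[OF j] by simp
  qed
  have cnt: "card {j \<in> {..<n}. a < s j \<and> s j \<le> b} = b - a" if b: "b \<le> n" for a b
  proof -
    have "s ` {j \<in> {..<n}. a < s j \<and> s j \<le> b} = {a<..b}"
    proof (intro equalityI subsetI)
      fix p assume "p \<in> {a<..b}"
      moreover from this obtain j where "j < n" "s j = p" using ex[of p] b by auto
      ultimately show "p \<in> s ` {j \<in> {..<n}. a < s j \<and> s j \<le> b}" by force
    qed auto
    moreover have "inj_on s {j \<in> {..<n}. a < s j \<and> s j \<le> b}" using inj by (auto simp: inj_on_def)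
    ultimately show ?thesis by (metis card_image card_greaterThanAtMost)
  qed
  have rank: "ranking_on {..<n} r"
    unfolding ranking_on_def
  proof
    fix i assume i: "i \<in> {..<n}"
    have "{j \<in> {..<n}. r j < r i} = {j \<in> {..<n}. 0 < s j \<and> s j \<le> r i}"
      using r_less_iff i rng(1) by force
    moreover have "r i \<le> n" using r_less[of i] rng(2)[of i] i by simp
    ultimately show "r i = card {j \<in> {..<n}. r j < r i}" using cnt[of "r i" 0] by simp
  qed
  \<comment> \<open>A displaced car arrives after the car one spot earlier, so arrival order and spot order
    agree within a block.\<close>
  have order: "i \<le> j" if "i < n" "j < n" "r i = r j" "s i \<le> s j" for i j
    using that
  proof (induction "s j" arbitrary: j rule: less_induct)
    case less
    show ?case
    proof (cases "s i = s j")
      case True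
      then show ?thesis using inj less.prems by blast
    next
      case False
      then have lt: "s i < s j" using less.prems by simp
      \<comment> \<open>An undisplaced \<open>j\<close> would start a new run at \<open>s j\<close>,
        beyond \<open>s i\<close>, contrary to \<open>r i = r j\<close>.\<close>
      then have "s j \<noteq> \<alpha> ! j"
        using B[OF rng[OF less.prems(2)]] Br[OF less.prems(2)] r_less[OF less.prems(1)] less.prems
        by (metis Suc_leI leD le_trans less_le_trans order_refl)
      then obtain l where l: "l < j" "s j = Suc (s l)" using st[OF less.prems(2)] by auto
      have "l < n" using l less.prems by simp
      \<comment> \<open>The car \<open>l\<close> lies between \<open>i\<close> and \<open>j\<close>
        on the street, so it shares their run and the induction hypothesis applies to it.\<close>
      have "\<not> r l < r i" using r_less_iff[OF less.prems(1) \<open>l < n\<close>] lt l(2) r_less[OF less.prems(1)] by simp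
      moreover have "\<not> r j < r l"
        using r_less_iff[OF \<open>l < n\<close> less.prems(2)] l(2) r_less[OF \<open>l < n\<close>] by simp
      ultimately have "r i = r l" using less.prems(3) by simp
      then have "i \<le> l" using less.hyps[of l] l lt \<open>l < n\<close> less.prems by simp
      then show ?thesis using l by simp
    qed
  qed
  \<comment> \<open>As arrival order and spot order agree in a run, the earlier tied cars are
    exactly those in the spots from \<open>Suc (r i)\<close> to \<open>s i - 1\<close>.\<close>
  have ties: "ties_before r i = s i - 1 - r i" if i: "i < n" for i
  proof -
    have "j < i \<and> r j = r i \<longleftrightarrow> j \<in> {..<n} \<and> r i < s j \<and> s j \<le> s i - 1" for j
    proof
      assume a: "j < i \<and> r j = r i"
      then have "j < n" using i by simp
      moreover have "\<not> s i \<le> s j" using order[OF i \<open>j < n\<close>] a by auto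
      ultimately show "j \<in> {..<n} \<and> r i < s j \<and> s j \<le> s i - 1" using r_less[of j] a by auto
    next
      assume a: "j \<in> {..<n} \<and> r i < s j \<and> s j \<le> s i - 1"
      then have j: "j < n" by simp
      have lt: "s j < s i" using a rng[OF i] by linarith
      have "\<not> r j < r i" using r_less_iff[OF i j] a by simp
      moreover have "\<not> r i < r j" using r_less_iff[OF j i] lt r_less[OF j] by simp
      ultimately have "r j = r i" by simp
      moreover have "j \<noteq> i" using lt by auto
      ultimately show "j < i \<and> r j = r i" using order[OF j i] lt by auto
    qed
    then have "{j. j < i \<and> r j = r i} = {j \<in> {..<n}. r i < s j \<and> s j \<le> s i - 1}" by blast
    then show ?thesis unfolding ties_before_def using cnt[of "s i - 1" "r i"] rng[OF i] by simp
  qed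
  have "r i + max 1 (ties_before r i) = \<alpha> ! i" if i: "i < n" for i
  proof (cases "s i = \<alpha> ! i")
    case True
    then have "s i = Suc (r i)" using B[OF rng[OF i]] Br[OF i] i by (metis le_antisym order_refl)
    then show ?thesis using ties[OF i] True by simp
  next
    case False
    then have a: "s i = Suc (\<alpha> ! i)" using st[OF i] by simp
    obtain l where l: "l < n" "s l = \<alpha> ! l" "s l = Suc (r i)"
      using B[OF rng[OF i]] Br[OF i] by auto
    \<comment> \<open>The start of the run belongs to the undisplaced car \<open>l\<close>. Hence
      \<open>i\<close> has an earlier tied car, and \<open>max 1\<close> leaves
      \<open>ties_before r i\<close> unchanged.\<close>
    then have "s i \<noteq> Suc (r i)" using False inj[OF _ l(1) i] by auto
    then show ?thesis using ties[OF i] a r_less[OF i] by simp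
  qed
  then have "ranking_prefs n r = \<alpha>"
    by (intro nth_equalityI) (auto simp: len ranking_prefs_def)
  then show ?thesis using that rank by blast
qed

section \<open>Faces of the permutohedron and rankings\<close>

definition labelings :: "('n::finite \<Rightarrow> nat) set" where
  "labelings = {w. bij_betw w UNIV {1..CARD('n)}}"

definition label_vec :: "('n::finite \<Rightarrow> nat) \<Rightarrow> real ^ 'n" where
  "label_vec w = (\<chi> i. real (w i))"

text \<open>The linear extensions of the weak order induced by \<open>a\<close>. The value type is
  general so that \<open>a\<close> may be a ranking or the coordinate function \<open>($) x\<close>
  of a functional.\<close>

definition compatible :: "('n::finite \<Rightarrow> 'b::linorder) \<Rightarrow> ('n \<Rightarrow> nat) set" where
  "compatible a = {w \<in> labelings. \<forall>i j. a i < a j \<longrightarrow> w i < w j}"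

lemma permutohedron_eq: "permutohedron = convex hull (label_vec ` labelings)"
  unfolding permutohedron_def
  by (rule arg_cong[where f = "\<lambda>S. convex hull S"]) (auto simp: labelings_def label_vec_def)

lemma finite_labelings: "finite (labelings :: ('n::finite \<Rightarrow> nat) set)"
proof (rule finite_subset)
  show "(labelings :: ('n \<Rightarrow> nat) set) \<subseteq> PiE UNIV (\<lambda>_. {1..CARD('n)})"
    by (auto simp: labelings_def dest: bij_betwE)
qed (simp add: finite_PiE)

lemma labelings_nonempty: "(labelings :: ('n::finite \<Rightarrow> nat) set) \<noteq> {}"
proof -
  obtain w :: "'n \<Rightarrow> nat" where "bij_betw w UNIV {1..CARD('n)}"
    using finite_same_card_bij[of "UNIV :: 'n set" "{1..CARD('n)}"] by auto
  then show ?thesis by (auto simp: labelings_def)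
qed

lemma label_vec_eq_iff: "label_vec w = label_vec w' \<longleftrightarrow> w = w'"
  by (auto simp: label_vec_def vec_eq_iff)

lemma inner_label_vec: "x \<bullet> label_vec w = (\<Sum>i\<in>UNIV. x $ i * real (w i))"
  by (simp add: inner_vec_def label_vec_def)

lemma labelings_inj: "w \<in> labelings \<Longrightarrow> w i = w j \<longleftrightarrow> i = j"
  by (auto simp: labelings_def bij_betw_def inj_on_def)

lemma labelings_transpose:
  assumes "w \<in> labelings" shows "w \<circ> Transposition.transpose i j \<in> labelings"
  using assms unfolding labelings_def by (auto intro: bij_betw_trans[OF bij_transpose])

lemma compatible_transpose:
  assumes "w \<in> compatible a" "a i = a j"
  shows "w \<circ> Transposition.transpose i j \<in> compatible a"
proof -
  have "a (Transposition.transpose i j l) = a l" for l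
    using assms(2) by (auto simp: Transposition.transpose_def)
  then show ?thesis
    using assms(1) labelings_transpose unfolding compatible_def by fastforce
qed

text \<open>Only the terms at \<open>i\<close> and \<open>j\<close> change. This exchange identity
  serves both to test maximality and to find the vectors orthogonal to a face.\<close>

lemma inner_label_vec_transpose:
  "x \<bullet> label_vec (w \<circ> Transposition.transpose i j) - x \<bullet> label_vec w
     = (x $ i - x $ j) * (real (w j) - real (w i))"
proof (cases "i = j")
  case False
  let ?w = "w \<circ> Transposition.transpose i j"
  have split: "x \<bullet> label_vec v = x $ i * real (v i) + x $ j * real (v j) + (\<Sum>l\<in>UNIV - {i,j}. x $ l * real (v l))"
    for v :: "'a \<Rightarrow> nat"
  proof -
    have "(\<Sum>l\<in>{i,j}. x $ l * real (v l)) + (\<Sum>l\<in>UNIV - {i,j}. x $ l * real (v l)) = x \<bullet> label_vec v"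
      unfolding inner_label_vec by (subst sum.subset_diff[of "{i,j}" UNIV]) auto
    then show ?thesis using False by simp
  qed
  have "(\<Sum>l\<in>UNIV - {i,j}. x $ l * real (?w l)) = (\<Sum>l\<in>UNIV - {i,j}. x $ l * real (w l))"
    by (rule sum.cong) (auto simp: transpose_apply_other)
  then show ?thesis by (simp add: split algebra_simps)
qed simp

text \<open>The labels on \<open>A\<close> are closed downwards: a smaller label is used somewhere,
  and not outside \<open>A\<close>. An initial segment is determined by its size.\<close>

lemma labeling_image_initial:
  fixes w :: "'n::finite \<Rightarrow> nat"
  assumes w: "w \<in> labelings" and "\<And>i j. i \<in> A \<Longrightarrow> j \<notin> A \<Longrightarrow> w i < w j"
  shows "w ` A = {1..card A}"
proof -
  have rng: "range w = {1..CARD('n)}" and "inj w"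
    using w by (auto simp: labelings_def bij_betw_def)
  then have card: "card (w ` A) = card A" by (metis card_image inj_on_subset subset_UNIV)
  have "x \<in> {1..card A}" if "x \<in> w ` A" for x
  proof -
    have "p \<in> w ` A" if "p \<in> {1..x}" for p
    proof -
      have "x \<in> {1..CARD('n)}" using \<open>x \<in> w ` A\<close> rng by blast
      then have "p \<in> range w" using that rng by auto
      then obtain l where "p = w l" by blast
      then show ?thesis using assms(2) \<open>x \<in> w ` A\<close> that by (metis atLeastAtMost_iff image_iff not_le)
    qed
    then have "card {1..x} \<le> card (w ` A)" by (intro card_mono) auto
    then show ?thesis using card that rng by auto
  qed
  then show ?thesis using card by (intro card_subset_eq) auto
qed

text \<open>A block is a difference of two lower sets, whose labels form initial segments. Hence the
  labels used on it are the same for all compatible labelings.\<close>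

lemma compatible_image_level:
  assumes "w \<in> compatible a"
  shows "w ` {i. a i = v} = {1..card {i. a i \<le> v}} - {1..card {i. a i < v}}"
proof -
  have w: "w \<in> labelings" "\<And>i j. a i < a j \<Longrightarrow> w i < w j"
    using assms by (auto simp: compatible_def)
  have inj: "inj w" using w(1) by (auto simp: labelings_def bij_betw_def)
  have "{i. a i = v} = {i. a i \<le> v} - {i. a i < v}" by auto
  then have "w ` {i. a i = v} = w ` {i. a i \<le> v} - w ` {i. a i < v}"
    using inj by (simp add: image_set_diff)
  also have "w ` {i. a i \<le> v} = {1..card {i. a i \<le> v}}"
    by (rule labeling_image_initial) (use w in auto)
  also have "w ` {i. a i < v} = {1..card {i. a i < v}}"
    by (rule labeling_image_initial) (use w in auto)
  finally show ?thesis .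
qed

text \<open>On each block \<open>x\<close> is constant, so the block contributes this constant times
  the sum of its labels, which depends on \<open>a\<close> alone.\<close>

lemma inner_compatible_eq:
  assumes w: "w \<in> compatible a" "w' \<in> compatible a"
    and x: "\<And>i j. a i = a j \<Longrightarrow> x $ i = x $ j"
  shows "x \<bullet> label_vec w = x \<bullet> label_vec w'"
proof -
  have level: "(\<Sum>l | a l = a i. x $ l * real (u l)) = x $ i * real (\<Sum>(u ` {l. a l = a i}))"
    if "u \<in> compatible a" for u i
  proof -
    have "inj_on u {l. a l = a i}"
      using that by (auto simp: compatible_def inj_on_def labelings_inj)
    have "(\<Sum>l | a l = a i. x $ l * real (u l)) = (\<Sum>l | a l = a i. x $ i * real (u l))"
      by (intro sum.cong refl arg_cong2[where f = "(*)"]) (use x in blast)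
    also have "\<dots> = x $ i * real (\<Sum>l | a l = a i. u l)" by (simp add: sum_distrib_left)
    also have "(\<Sum>l | a l = a i. u l) = \<Sum>(u ` {l. a l = a i})"
      by (simp add: sum.reindex[OF \<open>inj_on u _\<close>])
    finally show ?thesis .
  qed
  have "x \<bullet> label_vec u = (\<Sum>v\<in>range a. \<Sum>l | a l = v. x $ l * real (u l))" for u
    unfolding inner_label_vec using sum.image_gen[of UNIV "\<lambda>l. x $ l * real (u l)" a] by simp
  moreover have "(\<Sum>v\<in>range a. \<Sum>l | a l = v. x $ l * real (w l))
      = (\<Sum>v\<in>range a. \<Sum>l | a l = v. x $ l * real (w' l))"
  proof (rule sum.cong[OF refl])
    fix v assume "v \<in> range a"
    then obtain i where "v = a i" by blast
    then show "(\<Sum>l | a l = v. x $ l * real (w l)) = (\<Sum>l | a l = v. x $ l * real (w' l))"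
      using level[OF w(1)] level[OF w(2)] compatible_image_level[OF w(1)] compatible_image_level[OF w(2)]
      by metis
  qed
  ultimately show ?thesis by simp
qed

text \<open>If two labels were in the wrong order, swapping them would increase the value.\<close>

lemma maximal_imp_compatible:
  assumes u: "u \<in> labelings" and max: "\<And>w. w \<in> labelings \<Longrightarrow> x \<bullet> label_vec w \<le> x \<bullet> label_vec u"
  shows "u \<in> compatible (($) x)"
proof -
  have "u i < u j" if "x $ i < x $ j" for i j
  proof (rule ccontr)
    assume "\<not> u i < u j"
    moreover have "u i \<noteq> u j" using labelings_inj[OF u] that by auto
    ultimately have "0 < (x $ i - x $ j) * (real (u j) - real (u i))"
      using that by (simp add: mult_neg_neg)
    then show False
      using inner_label_vec_transpose[of x u i j] max[OF labelings_transpose[OF u, of i j]] by simp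
  qed
  then show ?thesis using u by (auto simp: compatible_def)
qed

lemma maximal_labeling_exists:
  fixes x :: "real ^ 'n"
  obtains u where "u \<in> labelings" "\<And>w. w \<in> labelings \<Longrightarrow> x \<bullet> label_vec w \<le> x \<bullet> label_vec u"
proof -
  let ?S = "(\<lambda>u. x \<bullet> label_vec u) ` labelings"
  have fin: "finite ?S" using finite_labelings by blast
  moreover have "?S \<noteq> {}" using labelings_nonempty by blast
  ultimately obtain u where "u \<in> labelings" "Max ?S = x \<bullet> label_vec u"
    using Max_in[of ?S] by blast
  then show ?thesis using that fin by (metis Max_ge image_eqI)
qed

text \<open>Some maximizer exists and is compatible. All compatible labelings share one value, so
  they are all maximizers.\<close>

lemma compatible_iff_maximal:
  fixes x :: "real ^ 'n"
  shows "w \<in> compatible (($) x) \<longleftrightarrow>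
     w \<in> labelings \<and> (\<forall>w'\<in>labelings. x \<bullet> label_vec w' \<le> x \<bullet> label_vec w)"
proof
  assume w: "w \<in> compatible (($) x)"
  obtain u where u: "u \<in> labelings" "\<And>w. w \<in> labelings \<Longrightarrow> x \<bullet> label_vec w \<le> x \<bullet> label_vec u"
    using maximal_labeling_exists[of x] by blast
  have "x \<bullet> label_vec w = x \<bullet> label_vec u"
    by (rule inner_compatible_eq[OF w maximal_imp_compatible[OF u]])
  then show "w \<in> labelings \<and> (\<forall>w'\<in>labelings. x \<bullet> label_vec w' \<le> x \<bullet> label_vec w)"
    using u w by (auto simp: compatible_def)
qed (auto intro: maximal_imp_compatible)

lemma compatible_cong:
  assumes "\<And>i j. a i < a j \<longleftrightarrow> b i < b j"
  shows "compatible a = compatible b"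
  using assms by (simp add: compatible_def)

lemma compatible_nonempty:
  fixes r :: "'n::finite \<Rightarrow> nat"
  shows "compatible r \<noteq> {}"
proof -
  let ?x = "\<chi> i. real (r i)"
  obtain u where "u \<in> labelings" "\<And>w. w \<in> labelings \<Longrightarrow> ?x \<bullet> label_vec w \<le> ?x \<bullet> label_vec u"
    using maximal_labeling_exists[of ?x] by blast
  then have "u \<in> compatible (($) ?x)" by (rule maximal_imp_compatible)
  moreover have "compatible (($) ?x) = compatible r" by (rule compatible_cong) simp
  ultimately show ?thesis by blast
qed

section \<open>Faces as hulls of compatible labelings\<close>

definition ranking_face :: "('n::finite \<Rightarrow> 'b::linorder) \<Rightarrow> (real ^ 'n) set" where
  "ranking_face r = convex hull (label_vec ` compatible r)"

text \<open>A face of the hull of a finite set is the hull of some of its points, here of those on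
  the hyperplane; these are the maximizers of \<open>x\<close>. The second claim serves to recover
  the labelings from the face.\<close>

lemma exposed_face_eq_hull_compatible:
  fixes x :: "real ^ 'n"
  assumes le: "permutohedron \<subseteq> {y. x \<bullet> y \<le> b}" and ne: "permutohedron \<inter> {y. x \<bullet> y = b} \<noteq> {}"
  shows "permutohedron \<inter> {y. x \<bullet> y = b} = ranking_face (($) x)"
    and "label_vec ` labelings \<inter> {y. x \<bullet> y = b} = label_vec ` compatible (($) x)"
proof -
  let ?V = "label_vec ` labelings :: (real ^ 'n) set" and ?F = "permutohedron \<inter> {y. x \<bullet> y = b}"
  have face: "?F face_of permutohedron"
    using le by (intro face_of_Int_supporting_hyperplane_le) (auto simp: permutohedron_eq)
  have VP: "?V \<subseteq> permutohedron" by (simp add: permutohedron_eq hull_subset)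
  have "?F face_of convex hull ?V" using face by (simp add: permutohedron_eq)
  then obtain S where S: "S \<subseteq> ?V" "?F = convex hull S"
    using face_of_convex_hull_subset finite_imp_compact finite_imageI finite_labelings by metis
  have "S \<subseteq> ?V \<inter> {y. x \<bullet> y = b}" using S hull_subset[of S convex] by blast
  then have "?F \<subseteq> convex hull (?V \<inter> {y. x \<bullet> y = b})" using S by (metis hull_mono)
  moreover have "convex hull (?V \<inter> {y. x \<bullet> y = b}) \<subseteq> ?F"
    using VP face_of_imp_convex[OF face] by (intro hull_minimal) (auto simp: permutohedron_eq)
  ultimately have F: "?F = convex hull (?V \<inter> {y. x \<bullet> y = b})" by blast
  have le': "x \<bullet> label_vec w \<le> b" if "w \<in> labelings" for w
    using VP le that by blast
  \<comment> \<open>As the hyperplane meets the polytope, some labeling attains \<open>b\<close>,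
    which is thus the maximum and not merely an upper bound.\<close>
  obtain w0 where w0: "w0 \<in> labelings" "x \<bullet> label_vec w0 = b"
    using ne F by (auto simp: image_iff)
  show V: "?V \<inter> {y. x \<bullet> y = b} = label_vec ` compatible (($) x)"
  proof (intro equalityI subsetI)
    fix y assume "y \<in> ?V \<inter> {y. x \<bullet> y = b}"
    then show "y \<in> label_vec ` compatible (($) x)"
      using le' by (auto simp: compatible_iff_maximal)
  next
    fix y assume "y \<in> label_vec ` compatible (($) x)"
    then obtain w where w: "y = label_vec w" "w \<in> compatible (($) x)" by blast
    then have "w \<in> labelings" "x \<bullet> label_vec w0 \<le> x \<bullet> label_vec w"
      using w0 by (auto simp: compatible_iff_maximal)
    then show "y \<in> ?V \<inter> {y. x \<bullet> y = b}" using le'[of w] w0 w by auto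
  qed
  show "?F = ranking_face (($) x)" using F V by (simp add: ranking_face_def)
qed

text \<open>The ranks themselves serve as coefficients of an exposing functional.\<close>

lemma ranking_face_exposed:
  fixes r :: "'n::finite \<Rightarrow> nat"
  obtains x :: "real ^ 'n" and b where "permutohedron \<subseteq> {y. x \<bullet> y \<le> b}"
    "permutohedron \<inter> {y. x \<bullet> y = b} = ranking_face r"
    "label_vec ` labelings \<inter> {y. x \<bullet> y = b} = label_vec ` compatible r"
proof -
  define x :: "real ^ 'n" where "x = (\<chi> i. real (r i))"
  have C: "compatible (($) x) = compatible r" by (rule compatible_cong) (simp add: x_def)
  obtain w where w: "w \<in> compatible r" using compatible_nonempty by blast
  define b where "b = x \<bullet> label_vec w"
  have w': "w \<in> labelings" "\<And>w'. w' \<in> labelings \<Longrightarrow> x \<bullet> label_vec w' \<le> b"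
    using w unfolding C[symmetric] b_def by (auto simp: compatible_iff_maximal)
  have le: "permutohedron \<subseteq> {y. x \<bullet> y \<le> b}"
    unfolding permutohedron_eq using w'(2) by (intro hull_minimal) (auto simp: convex_halfspace_le)
  have "label_vec w \<in> permutohedron"
    unfolding permutohedron_eq using w'(1) by (intro hull_inc) auto
  then have ne: "permutohedron \<inter> {y. x \<bullet> y = b} \<noteq> {}" by (auto simp: b_def)
  show ?thesis
    using that[OF le] exposed_face_eq_hull_compatible[OF le ne] C by (simp add: ranking_face_def)
qed

lemma ranking_face_face_of: "ranking_face (r :: 'n::finite \<Rightarrow> nat) face_of permutohedron"
proof -
  obtain x b where "permutohedron \<subseteq> {y. x \<bullet> y \<le> b}" "permutohedron \<inter> {y. x \<bullet> y = b} = ranking_face r"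
    by (rule ranking_face_exposed)
  moreover have "convex (permutohedron :: (real ^ 'n) set)" by (simp add: permutohedron_eq)
  ultimately show ?thesis
    using face_of_Int_supporting_hyperplane_le[of permutohedron x b] by auto
qed

lemma face_is_ranking_face:
  fixes F :: "(real ^ 'n) set"
  assumes "F face_of permutohedron" "F \<noteq> {}"
  obtains r where "ranking_on UNIV r" "F = ranking_face r"
proof -
  have "polytope (permutohedron :: (real ^ 'n) set)"
    unfolding polytope_def permutohedron_eq using finite_labelings by blast
  then have "F exposed_face_of permutohedron"
    using assms(1) exposed_face_of_polyhedron polytope_imp_polyhedron by blast
  then obtain x b where xb: "permutohedron \<subseteq> {y. x \<bullet> y \<le> b}" "F = permutohedron \<inter> {y. x \<bullet> y = b}"
    unfolding exposed_face_of_def by blast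
  \<comment> \<open>The competition ranking of the coordinates of \<open>x\<close>, which orders the
    labels as \<open>x\<close> does.\<close>
  define r where "r i = card {j. x $ j < x $ i}" for i
  have less: "r i < r j \<longleftrightarrow> x $ i < x $ j" for i j
  proof
    assume "r i < r j"
    show "x $ i < x $ j"
    proof (rule ccontr)
      assume "\<not> x $ i < x $ j"
      then have "r j \<le> r i" unfolding r_def by (intro card_mono) auto
      then show False using \<open>r i < r j\<close> by simp
    qed
  next
    assume "x $ i < x $ j"
    then show "r i < r j" unfolding r_def by (intro psubset_card_mono) auto
  qed
  have "ranking_on UNIV r" unfolding ranking_on_def less by (simp add: r_def)
  moreover have "F = ranking_face r"
    using exposed_face_eq_hull_compatible(1)[OF xb(1)] assms(2) xb(2) compatible_cong[of r "($) x", OF less]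
    by (simp add: ranking_face_def)
  ultimately show ?thesis using that by blast
qed

text \<open>The compatible labelings determine the weak order: for tied \<open>i\<close> and
  \<open>j\<close>, swapping their labels gives a compatible labeling in the opposite order.\<close>

lemma compatible_less_iff:
  fixes r :: "'n::finite \<Rightarrow> nat"
  shows "r i < r j \<longleftrightarrow> (\<forall>w\<in>compatible r. w i < w j)"
proof
  show "\<forall>w\<in>compatible r. w i < w j" if "r i < r j" using that by (auto simp: compatible_def)
next
  assume all: "\<forall>w\<in>compatible r. w i < w j"
  obtain w where w: "w \<in> compatible r" using compatible_nonempty by blast
  show "r i < r j"
  proof (rule linorder_cases[of "r i" "r j"])
    assume "r i = r j"
    then have "(w \<circ> Transposition.transpose i j) i < (w \<circ> Transposition.transpose i j) j"
      using all compatible_transpose[OF w] by blast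
    moreover have "w i < w j" using all w by blast
    ultimately show ?thesis by simp
  next
    assume "r j < r i"
    then have "w j < w i" using w by (simp add: compatible_def)
    moreover have "w i < w j" using all w by blast
    ultimately show ?thesis by simp
  qed
qed

lemma ranking_face_inj:
  fixes r r' :: "'n::finite \<Rightarrow> nat"
  assumes "ranking_on UNIV r" "ranking_on UNIV r'" "ranking_face r = ranking_face r'"
  shows "r = r'"
proof -
  \<comment> \<open>The labelings in a face are those on its exposing hyperplane, so the face
    determines the compatible labelings, they determine the order, and the order determines the
    ranking by counting.\<close>
  have V: "label_vec ` labelings \<inter> ranking_face q = label_vec ` compatible q" for q :: "'n \<Rightarrow> nat"
  proof -
    obtain x b where "permutohedron \<inter> {y. x \<bullet> y = b} = ranking_face q"
      "label_vec ` labelings \<inter> {y. x \<bullet> y = b} = label_vec ` compatible q"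
      by (rule ranking_face_exposed)
    moreover have "label_vec ` labelings \<subseteq> (permutohedron :: (real ^ 'n) set)"
      by (simp add: permutohedron_eq hull_subset)
    ultimately show ?thesis by blast
  qed
  have "compatible r = compatible r'"
    using V[of r] V[of r'] assms(3) by (metis inj_image_eq_iff injI label_vec_eq_iff)
  then have "r i < r j \<longleftrightarrow> r' i < r' j" for i j
    using compatible_less_iff[of r i j] compatible_less_iff[of r' i j] by metis
  then have "{j \<in> UNIV. r j < r i} = {j \<in> UNIV. r' j < r' i}" for i by blast
  then show ?thesis using assms(1,2) unfolding ranking_on_def by (metis UNIV_I ext)
qed

section \<open>Dimension of a face\<close>

lemma dim_level_vectors:
  fixes r :: "'n::finite \<Rightarrow> 'b"
  shows "dim {x :: real ^ 'n. \<forall>i j. r i = r j \<longrightarrow> x $ i = x $ j} = card (range r)"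
proof -
  \<comment> \<open>The indicator vectors of the blocks form an orthogonal basis.\<close>
  define ind :: "'b \<Rightarrow> real ^ 'n" where "ind v = (\<chi> i. if r i = v then 1 else 0)" for v
  have orth: "ind u \<bullet> ind v = 0" if "u \<noteq> v" for u v
    using that by (auto simp: inner_vec_def ind_def intro!: sum.neutral)
  have nz: "ind v \<noteq> 0" if "v \<in> range r" for v
    using that by (auto simp: ind_def vec_eq_iff)
  have inj: "inj_on ind (range r)"
    by (rule inj_onI) (metis orth nz inner_eq_zero_iff)
  have "pairwise orthogonal (ind ` range r)"
    by (auto simp: pairwise_def orthogonal_def intro!: orth)
  then have "independent (ind ` range r)"
    by (rule pairwise_orthogonal_independent) (metis imageE nz)
  moreover have "span (ind ` range r) = {x. \<forall>i j. r i = r j \<longrightarrow> x $ i = x $ j}"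
  proof
    have "subspace {x :: real ^ 'n. \<forall>i j. r i = r j \<longrightarrow> x $ i = x $ j}"
    proof (rule subspaceI)
      show "x + y \<in> {x. \<forall>i j. r i = r j \<longrightarrow> x $ i = x $ j}"
        if "x \<in> {x. \<forall>i j. r i = r j \<longrightarrow> x $ i = x $ j}" "y \<in> {x. \<forall>i j. r i = r j \<longrightarrow> x $ i = x $ j}"
        for x y :: "real ^ 'n"
        using that unfolding mem_Collect_eq vector_add_component by metis
      show "c *\<^sub>R x \<in> {x. \<forall>i j. r i = r j \<longrightarrow> x $ i = x $ j}"
        if "x \<in> {x. \<forall>i j. r i = r j \<longrightarrow> x $ i = x $ j}" for c and x :: "real ^ 'n"
        using that unfolding mem_Collect_eq vector_scaleR_component by metis
    qed simp
    then show "span (ind ` range r) \<subseteq> {x. \<forall>i j. r i = r j \<longrightarrow> x $ i = x $ j}"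
      by (intro span_minimal) (auto simp: ind_def)
    show "{x. \<forall>i j. r i = r j \<longrightarrow> x $ i = x $ j} \<subseteq> span (ind ` range r)"
    proof
      fix x :: "real ^ 'n" assume "x \<in> {x. \<forall>i j. r i = r j \<longrightarrow> x $ i = x $ j}"
      then have x: "\<And>i j. r i = r j \<Longrightarrow> x $ i = x $ j" by blast
      \<comment> \<open>The coefficient of a block is the value of \<open>x\<close> at a
        representative chosen by \<open>inv r\<close>.\<close>
      have "x = (\<Sum>v\<in>range r. (x $ (inv r v)) *\<^sub>R ind v)"
      proof (simp add: vec_eq_iff, intro allI)
        fix i
        have "(\<Sum>v\<in>range r. x $ inv r v * ind v $ i) = (\<Sum>v\<in>range r. if v = r i then x $ inv r v else 0)"
          by (rule sum.cong) (auto simp: ind_def)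
        also have "\<dots> = x $ inv r (r i)" by (subst sum.delta) auto
        also have "\<dots> = x $ i" by (rule x) (simp add: f_inv_into_f)
        finally show "x $ i = (\<Sum>v\<in>range r. x $ inv r v * ind v $ i)" by simp
      qed
      also have "\<dots> \<in> span (ind ` range r)"
        by (intro span_sum span_scale span_base) auto
      finally show "x \<in> span (ind ` range r)" .
    qed
  qed
  ultimately show ?thesis
    by (metis card_image dim_span_eq_card_independent inj)
qed

text \<open>Translating a vertex to the origin turns the affine dimension into that of a span, whose
  orthogonal complement consists of the vectors constant on blocks.\<close>

lemma aff_dim_ranking_face:
  fixes r :: "'n::finite \<Rightarrow> nat"
  shows "aff_dim (ranking_face r) + int (card (range r)) = int CARD('n)"
proof -
  obtain w where w: "w \<in> compatible r" using compatible_nonempty by blast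
  let ?D = "(+) (- label_vec w) ` label_vec ` compatible r"
  have "aff_dim (ranking_face r) = int (dim ?D)"
    unfolding ranking_face_def aff_dim_convex_hull
    by (rule aff_dim_eq_dim) (use w in \<open>auto intro: hull_inc\<close>)
  moreover have "dim {y \<in> UNIV. \<forall>x \<in> span ?D. orthogonal x y} + dim (span ?D) = dim (UNIV :: (real ^ 'n) set)"
    by (rule dim_subspace_orthogonal_to_vectors) auto
  moreover have "{y \<in> UNIV. \<forall>x \<in> span ?D. orthogonal x y} = {x. \<forall>i j. r i = r j \<longrightarrow> x $ i = x $ j}"
    (is "?L = ?R")
  proof (intro equalityI subsetI)
    fix y assume y: "y \<in> ?L"
    have "y $ i = y $ j" if "r i = r j" for i j
    proof (cases "i = j")
      case False
      \<comment> \<open>Swapping two tied labels moves the vertex by a nonzero multiple of the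
        difference of two unit vectors, so orthogonality forces equal coordinates.\<close>
      let ?u = "w \<circ> Transposition.transpose i j"
      have "- label_vec w + label_vec ?u \<in> span ?D"
        using compatible_transpose[OF w that] by (intro span_base) blast
      then have "y \<bullet> (- label_vec w + label_vec ?u) = 0"
        using y by (auto simp: orthogonal_def inner_commute)
      then have "(y $ i - y $ j) * (real (w j) - real (w i)) = 0"
        using inner_label_vec_transpose[of y w i j] by (simp add: inner_diff_right)
      moreover have "w j \<noteq> w i" using w False by (auto simp: compatible_def labelings_inj)
      ultimately show ?thesis by simp
    qed simp
    then show "y \<in> ?R" by blast
  next
    fix y assume y: "y \<in> ?R"
    have "orthogonal y d" if "d \<in> ?D" for d
    proof -
      obtain u where u: "u \<in> compatible r" "d = - label_vec w + label_vec u" using \<open>d \<in> ?D\<close> by blast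
      have "y \<bullet> label_vec u = y \<bullet> label_vec w"
        by (rule inner_compatible_eq[OF u(1) w]) (use y in blast)
      then show ?thesis by (simp add: u orthogonal_def inner_diff_right)
    qed
    then have "orthogonal y x" if "x \<in> span ?D" for x
      using orthogonal_to_span[OF that] by blast
    then show "y \<in> ?L" using orthogonal_commute by blast
  qed
  ultimately show ?thesis using dim_level_vectors[of r] by (simp add: dim_span)
qed

lemma bij_betw_rankings_faces:
  "bij_betw ranking_face {r :: 'n::finite \<Rightarrow> nat. ranking_on UNIV r \<and> card (range r) + k = CARD('n)}
    {F. F face_of (permutohedron :: (real ^ 'n) set) \<and> aff_dim F = int k}"
proof (rule bij_betw_imageI)
  show "inj_on ranking_face {r :: 'n \<Rightarrow> nat. ranking_on UNIV r \<and> card (range r) + k = CARD('n)}"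
    by (rule inj_onI) (use ranking_face_inj in blast)
  have dim: "aff_dim (ranking_face r) = int k \<longleftrightarrow> card (range r) + k = CARD('n)" for r :: "'n \<Rightarrow> nat"
    using aff_dim_ranking_face[of r] by linarith
  show "ranking_face ` {r :: 'n \<Rightarrow> nat. ranking_on UNIV r \<and> card (range r) + k = CARD('n)}
      = {F. F face_of permutohedron \<and> aff_dim F = int k}"
  proof (intro equalityI subsetI)
    fix F :: "(real ^ 'n) set" assume F: "F \<in> {F. F face_of permutohedron \<and> aff_dim F = int k}"
    \<comment> \<open>The empty face has affine dimension -1, which is not of the form
      \<open>int k\<close>.\<close>
    then have "F \<noteq> {}" by auto
    then obtain r where "ranking_on UNIV r" "F = ranking_face r"
      using F face_is_ranking_face by blast
    then show "F \<in> ranking_face ` {r :: 'n \<Rightarrow> nat. ranking_on UNIV r \<and> card (range r) + k = CARD('n)}"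
      using F dim by blast
  qed (use dim ranking_face_face_of in blast)
qed

section \<open>The bijection\<close>

text \<open>The enumeration \<open>e\<close> of the labels serves as the order of arrival, and
  composing with it turns rankings of labels into rankings of cars.\<close>

lemma bij_betw_rankings_unit_interval:
  assumes e: "bij_betw e {..<CARD('n)} (UNIV :: 'n::finite set)"
  shows "bij_betw (\<lambda>r. ranking_prefs CARD('n) (r \<circ> e))
    {r :: 'n \<Rightarrow> nat. ranking_on UNIV r \<and> card (range r) + k = CARD('n)}
    {\<alpha>. unit_interval_parking_function CARD('n) \<alpha> \<and> total_displacement \<alpha> = k}"
proof -
  let ?n = "CARD('n)"
  have rank: "ranking_on {..<?n} (r \<circ> e) \<longleftrightarrow> ranking_on UNIV r" for r :: "'n \<Rightarrow> nat"
  proof -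
    have "card {j \<in> {..<?n}. r (e j) < v} = card {j. r j < v}" for v
    proof (rule bij_betw_same_card[of e])
      have "e ` {j \<in> {..<?n}. r (e j) < v} = {j. r j < v}"
        using e unfolding bij_betw_def by (auto simp: image_iff)
      then show "bij_betw e {j \<in> {..<?n}. r (e j) < v} {j. r j < v}"
        using e by (auto simp: bij_betw_def inj_on_def)
    qed
    moreover have "(\<forall>i\<in>{..<?n}. P (e i)) \<longleftrightarrow> (\<forall>i. P i)" for P
      using e unfolding bij_betw_def by (metis UNIV_I imageE imageI)
    ultimately show ?thesis by (simp add: ranking_on_def)
  qed
  have img: "(r \<circ> e) ` {..<?n} = range r" for r :: "'n \<Rightarrow> nat"
    using e by (metis bij_betw_imp_surj_on image_comp)
  show ?thesis
  proof (rule bij_betw_imageI)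
    show "inj_on (\<lambda>r. ranking_prefs ?n (r \<circ> e)) {r. ranking_on UNIV r \<and> card (range r) + k = ?n}"
    proof (rule inj_onI, rule ext)
      fix r r' :: "'n \<Rightarrow> nat" and x
      assume A: "r \<in> {r. ranking_on UNIV r \<and> card (range r) + k = ?n}"
        "r' \<in> {r. ranking_on UNIV r \<and> card (range r) + k = ?n}"
        "ranking_prefs ?n (r \<circ> e) = ranking_prefs ?n (r' \<circ> e)"
      obtain i where "i < ?n" "e i = x" using e unfolding bij_betw_def by (metis UNIV_I imageE lessThan_iff)
      then show "r x = r' x"
        using ranking_prefs_inj[of ?n "r \<circ> e" "r' \<circ> e" i] A rank by auto
    qed
    show "(\<lambda>r. ranking_prefs ?n (r \<circ> e)) ` {r. ranking_on UNIV r \<and> card (range r) + k = ?n}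
        = {\<alpha>. unit_interval_parking_function ?n \<alpha> \<and> total_displacement \<alpha> = k}"
    proof (intro equalityI subsetI)
      fix \<alpha> assume "\<alpha> \<in> (\<lambda>r. ranking_prefs ?n (r \<circ> e)) ` {r. ranking_on UNIV r \<and> card (range r) + k = ?n}"
      then obtain r where r: "ranking_on {..<?n} (r \<circ> e)" "card (range r) + k = ?n" "\<alpha> = ranking_prefs ?n (r \<circ> e)"
        using rank by blast
      then show "\<alpha> \<in> {\<alpha>. unit_interval_parking_function ?n \<alpha> \<and> total_displacement \<alpha> = k}"
        using unit_parks_imp_unit_interval[OF ranking_unit_parks[OF r(1)]]
          ranking_total_displacement[OF r(1)] unfolding img by simp
    next
      fix \<alpha> assume A: "\<alpha> \<in> {\<alpha>. unit_interval_parking_function ?n \<alpha> \<and> total_displacement \<alpha> = k}"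
      then obtain q where q: "ranking_on {..<?n} q" "ranking_prefs ?n q = \<alpha>"
        using ranking_prefs_surj[OF unit_interval_imp_unit_parks] by blast
      \<comment> \<open>The ranking \<open>q\<close> of cars is carried back to the labels. Since
        \<open>r \<circ> e\<close> is only known to agree with \<open>q\<close> below
        \<open>?n\<close>, the ranking property and the preferences are checked again for
        it.\<close>
      define r where "r = q \<circ> inv_into {..<?n} e"
      have eq: "(r \<circ> e) i = q i" if "i < ?n" for i
        using e that by (simp add: r_def bij_betw_def inv_into_f_f)
      have "ranking_on {..<?n} (r \<circ> e)"
      proof -
        have "{j \<in> {..<?n}. (r \<circ> e) j < v} = {j \<in> {..<?n}. q j < v}" for v using eq by auto
        then show ?thesis using q(1) eq by (simp add: ranking_on_def del: comp_apply)
      qed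
      moreover have "ranking_prefs ?n (r \<circ> e) = \<alpha>"
      proof -
        have "ties_before (r \<circ> e) i = ties_before q i" if "i < ?n" for i
          unfolding ties_before_def using eq that
          by (intro arg_cong[where f = card] Collect_cong) (metis less_trans)
        then show ?thesis using q(2) eq by (auto simp: ranking_prefs_def simp del: comp_apply)
      qed
      moreover have "card (range r) + k = ?n"
        using ranking_total_displacement[OF calculation(1)] calculation(2) A unfolding img by simp
      ultimately show "\<alpha> \<in> (\<lambda>r. ranking_prefs ?n (r \<circ> e)) ` {r. ranking_on UNIV r \<and> card (range r) + k = ?n}"
        using rank by blast
    qed
  qed
qed

theorem theorem3p9:
  fixes k :: nat
  assumes "k \<le> CARD('n::finite)"
  shows "\<exists>f. bij_betw f
           {F. F face_of (permutohedron :: (real ^ 'n) set) \<and> aff_dim F = int k}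
           {\<alpha>. unit_interval_parking_function CARD('n) \<alpha> \<and> total_displacement \<alpha> = k}"
proof -
  obtain e where e: "bij_betw e {..<CARD('n)} (UNIV :: 'n set)"
    using finite_same_card_bij[of "{..<CARD('n)}" "UNIV :: 'n set"] by auto
  \<comment> \<open>From a face to its ranking, then to the preferences; both bijections use the
    rankings with \<open>CARD('n) - k\<close> blocks.\<close>
  show ?thesis
    using bij_betw_trans[OF bij_betw_inv_into[OF bij_betw_rankings_faces]
        bij_betw_rankings_unit_interval[OF e]] by blast
qed

end
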